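(* For all integers $k\ge 3$ and $1\le b\le k-1$ there exists $s_0>0$ such that the following holds for every integer $s\ge s_0$. Let $H$ be a $k$-graph on $n$ vertices, where $n\ge (2(2k-b)^2+1)(k-1)s+s$. If $$e(H)\ge \binom{n}{k}-\binom{n-s+1}{k}+\binom{n-1}{k-1}+\binom{n-1}{k-2}(2k-b)s,$$ then $H$ contains a $Y_{k,b}$-tiling of size $s$.
   Context: A $k$-graph ($k$-uniform hypergraph) $H=(V,E)$ consists of a finite vertex set $V$ and a family $E$ of $k$-element subsets of $V$ (edges); $e(H)=|E|$. For $k>b\ge 0$, $Y_{k,b}$ denotes the $k$-graph on $2k-b$ vertices consisting of two edges that intersect in exactly $b$ vertices. Given $k$-graphs $F$ and $H$, an $F$-tiling in $H$ is a subgraph of $H$ consisting of vertex-disjoint copies of $F$ (copies are not necessarily induced); its size is the number of these copies. *)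

theory Defs
  imports Complex_Main "HOL-Library.Disjoint_Sets"
begin

datatype 'a hypergraph = Hypergraph (verts: "'a set") (edges: "'a set set")

definition kgraph :: "nat \<Rightarrow> 'a hypergraph \<Rightarrow> bool" where
  "kgraph k H \<longleftrightarrow> finite (verts H) \<and> (\<forall>e\<in>edges H. e \<subseteq> verts H \<and> card e = k)"

definition subhypergraph :: "'a hypergraph \<Rightarrow> 'a hypergraph \<Rightarrow> bool" where
  "subhypergraph G H \<longleftrightarrow> verts G \<subseteq> verts H \<and> edges G \<subseteq> edges H"

definition hypergraph_iso :: "'a hypergraph \<Rightarrow> 'b hypergraph \<Rightarrow> bool" where
  "hypergraph_iso F G \<longleftrightarrow>
     (\<exists>f. bij_betw f (verts F) (verts G) \<and> edges G = (\<lambda>e. f ` e) ` edges F)"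

text \<open>Copies are subgraphs, not necessarily induced ones.\<close>

definition copy_in :: "'b hypergraph \<Rightarrow> 'a hypergraph \<Rightarrow> 'a hypergraph \<Rightarrow> bool" where
  "copy_in F H C \<longleftrightarrow> subhypergraph C H \<and> hypergraph_iso F C"

text \<open>A tiling is represented by the set of the copies it consists of,
  so that its size is the cardinality of this set.\<close>

definition tiling :: "'b hypergraph \<Rightarrow> 'a hypergraph \<Rightarrow> 'a hypergraph set \<Rightarrow> bool" where
  "tiling F H \<T> \<longleftrightarrow> finite \<T> \<and> (\<forall>C\<in>\<T>. copy_in F H C) \<and> disjoint_family_on verts \<T>"

text \<open>A concrete representative of the isomorphism class of \<open>Y\<^sub>k\<^sub>,\<^sub>b\<close>, meaningful for \<open>b < k\<close>.\<close>

definition Y :: "nat \<Rightarrow> nat \<Rightarrow> nat hypergraph" where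
  "Y k b = Hypergraph {..<2 * k - b} {{..<k}, {k - b..<2 * k - b}}"

lemma Y_properties:
  assumes "b < k"
  shows "kgraph k (Y k b)" and "card (verts (Y k b)) = 2 * k - b"
    and "card (edges (Y k b)) = 2" and "card ({..<k} \<inter> {k - b..<2 * k - b}) = b"
proof -
  have ne: "{..<k} \<noteq> {k - b..<2 * k - b}"
  proof
    assume "{..<k} = {k - b..<2 * k - b}"
    moreover have "0 \<in> {..<k}" using assms by simp
    ultimately show False using assms by simp
  qed
  have int: "{..<k} \<inter> {k - b..<2 * k - b} = {k - b..<k}" using assms by auto
  show "kgraph k (Y k b)" using assms by (auto simp: kgraph_def Y_def)
  show "card (verts (Y k b)) = 2 * k - b" by (simp add: Y_def)
  show "card (edges (Y k b)) = 2" using ne by (simp add: Y_def)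
  show "card ({..<k} \<inter> {k - b..<2 * k - b}) = b" using assms by (simp add: int)
qed

end

theory Submission
  imports Defs
begin

text \<open>Two bounds drive the proof. First, a \<open>k\<close>-graph on \<open>n > k\<^sup>3\<close> vertices without two edges meeting
  in exactly \<open>b\<close> vertices has at most \<open>(n - 1) choose (k - 1)\<close> edges: passing to vertex links reduces
  this to \<open>b = 0\<close>, where a non-trivial intersecting family has at most \<open>k\<^sup>2 ((n - 2) choose (k - 2))\<close>
  members. Second, the threshold drops by at least \<open>(n - 1) choose (k - 1)\<close> when \<open>n\<close> and \<open>s\<close> both
  decrease by one, so by induction on \<open>s\<close> every \<open>H - v\<close> has a tiling of size \<open>s - 1\<close>. If \<open>v\<close> has degree
  more than \<open>(t (s - 1) + 1) ((n - 2) choose (k - 2))\<close>, with \<open>t = 2 k - b\<close>, then its link still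
  contains a \<open>Y\<^sub>k\<^sub>-\<^sub>1\<^sub>,\<^sub>b\<^sub>-\<^sub>1\<close> outside that tiling. If all degrees are smaller, then the tiling meets so few
  edges that the first bound applies to the remaining ones.\<close>

section \<open>Families without two members meeting in \<open>b\<close> points\<close>

text \<open>Every such A is B \<union> X for some (k - |X|)-subset B of V - X. With |X| = 1 or 2
  this bounds degrees and pair degrees.\<close>

lemma card_supersets_le:
  assumes "finite V" and "finite X"
  shows "card {A. X \<subseteq> A \<and> A \<subseteq> V \<and> card A = k} \<le> (card V - card X) choose (k - card X)"
proof (cases "X \<subseteq> V")
  case True
  let ?S = "{B. B \<subseteq> V - X \<and> card B = k - card X}"
  have "{A. X \<subseteq> A \<and> A \<subseteq> V \<and> card A = k} \<subseteq> (\<lambda>B. B \<union> X) ` ?S"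
  proof
    fix A assume A: "A \<in> {A. X \<subseteq> A \<and> A \<subseteq> V \<and> card A = k}"
    hence "A - X \<in> ?S" using assms by (auto simp: card_Diff_subset)
    moreover have "A = (A - X) \<union> X" using A by auto
    ultimately show "A \<in> (\<lambda>B. B \<union> X) ` ?S" by blast
  qed
  moreover have "finite ?S" using assms by simp
  ultimately have "card {A. X \<subseteq> A \<and> A \<subseteq> V \<and> card A = k} \<le> card ?S"
    by (meson surj_card_le)
  also have "\<dots> = (card V - card X) choose (k - card X)"
    using assms True by (simp add: n_subsets card_Diff_subset)
  finally show ?thesis .
next
  case False
  hence "{A. X \<subseteq> A \<and> A \<subseteq> V \<and> card A = k} = {}" by auto
  thus ?thesis by (metis card.empty zero_le)
qed

text \<open>A union bound over the points of the transversal X. Below, X is a member of an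
  intersecting family or the set covered by a tiling.\<close>

lemma card_uniform_inter_le:
  assumes "finite V" and "F \<subseteq> {A. A \<subseteq> V \<and> card A = k}" and "finite X"
    and "\<And>A. A \<in> F \<Longrightarrow> X \<inter> A \<noteq> {}" and "\<And>x. x \<in> X \<Longrightarrow> card {A \<in> F. x \<in> A} \<le> d"
  shows "card F \<le> card X * d"
proof -
  have finF: "finite F" using assms(1,2) by (auto intro: finite_subset[of F "Pow V"])
  have "F \<subseteq> (\<Union>x\<in>X. {A \<in> F. x \<in> A})" using assms(4) by blast
  hence "card F \<le> card (\<Union>x\<in>X. {A \<in> F. x \<in> A})" using finF assms(3) by (intro card_mono) auto
  also have "\<dots> \<le> (\<Sum>x\<in>X. card {A \<in> F. x \<in> A})" by (rule card_UN_le[OF assms(3)])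
  also have "\<dots> \<le> card X * d" using sum_bounded_above[of X _ d] assms(5) by simp
  finally show ?thesis .
qed

lemma card_le_meeting_plus_avoiding:
  assumes "finite V" and F: "F \<subseteq> {A. A \<subseteq> V \<and> card A = k}" and "finite U"
    and deg: "\<And>x. x \<in> U \<Longrightarrow> card {A \<in> F. x \<in> A} \<le> d"
  shows "card F \<le> card U * d + card {A \<in> F. U \<inter> A = {}}"
proof -
  let ?M = "{A \<in> F. U \<inter> A \<noteq> {}}"
  have finF: "finite F" using assms(1,2) by (auto intro: finite_subset[of F "Pow V"])
  have "card ?M \<le> card U * d"
  proof (rule card_uniform_inter_le[OF assms(1) _ assms(3)])
    show "?M \<subseteq> {A. A \<subseteq> V \<and> card A = k}" using F by blast
    fix x assume x: "x \<in> U"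
    have "card {A \<in> ?M. x \<in> A} \<le> card {A \<in> F. x \<in> A}"
      using finF by (intro card_mono) auto
    thus "card {A \<in> ?M. x \<in> A} \<le> d" using deg[OF x] by linarith
  qed blast
  moreover have "card F = card (?M \<union> {A \<in> F. U \<inter> A = {}})" by (rule arg_cong[of _ _ card]) blast
  ultimately show ?thesis using card_Un_le[of ?M "{A \<in> F. U \<inter> A = {}}"] by linarith
qed

text \<open>A weak Erdos-Ko-Rado bound. If no point is common to all members, each x is missed by
  some B in F. Every member through x then contains a pair {x, y} with y in B, so x has degree at
  most k ((n - 2) choose (k - 2)), where n = |V|. Summing over the points of one fixed member gives
  k^2 ((n - 2) choose (k - 2)).\<close>

lemma card_intersecting_le:
  assumes "finite V" and "card V > k ^ 3" and "0 < k" and F: "F \<subseteq> {A. A \<subseteq> V \<and> card A = k}"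
    and inter: "\<And>A B. A \<in> F \<Longrightarrow> B \<in> F \<Longrightarrow> A \<inter> B \<noteq> {}"
  shows "card F \<le> (card V - 1) choose (k - 1)"
proof (cases "\<exists>x. \<forall>A\<in>F. x \<in> A")
  case True
  then obtain x where "\<forall>A\<in>F. x \<in> A" by blast
  hence "F \<subseteq> {A. {x} \<subseteq> A \<and> A \<subseteq> V \<and> card A = k}" using F by auto
  moreover have "finite {A. {x} \<subseteq> A \<and> A \<subseteq> V \<and> card A = k}"
    using assms(1) by (auto intro: finite_subset[of _ "Pow V"])
  ultimately have "card F \<le> card {A. {x} \<subseteq> A \<and> A \<subseteq> V \<and> card A = k}" by (rule card_mono[rotated])
  also have "\<dots> \<le> (card V - 1) choose (k - 1)"
    using card_supersets_le[of V "{x}" k] assms(1) by simp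
  finally show ?thesis .
next
  case False
  \<comment> \<open>The empty family vacuously has a common point, so F is nonempty here.\<close>
  then obtain A where A: "A \<in> F" by blast
  have finA: "finite B" "card B = k" if "B \<in> F" for B
    using F that assms(1) finite_subset by blast+
  have fin2: "finite {A. X \<subseteq> A \<and> A \<subseteq> V \<and> card A = k}" for X
    using assms(1) by (auto intro: finite_subset[of _ "Pow V"])
  have deg: "card {B \<in> F. x \<in> B} \<le> k * ((card V - 2) choose (k - 2))" for x
  proof -
    obtain B where B: "B \<in> F" "x \<notin> B" using False by blast
    have "card {C \<in> F. x \<in> C} \<le> card B * ((card V - 2) choose (k - 2))"
    proof (rule card_uniform_inter_le[OF assms(1)])
      show "{C \<in> F. x \<in> C} \<subseteq> {A. A \<subseteq> V \<and> card A = k}" using F by blast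
      show "finite B" using finA B by blast
      show "B \<inter> C \<noteq> {}" if "C \<in> {C \<in> F. x \<in> C}" for C using inter B that by blast
      fix y assume y: "y \<in> B"
      have "{C \<in> {C \<in> F. x \<in> C}. y \<in> C} \<subseteq> {C. {x, y} \<subseteq> C \<and> C \<subseteq> V \<and> card C = k}"
        using F by auto
      hence "card {C \<in> {C \<in> F. x \<in> C}. y \<in> C} \<le> card {C. {x, y} \<subseteq> C \<and> C \<subseteq> V \<and> card C = k}"
        by (rule card_mono[OF fin2])
      also have "\<dots> \<le> (card V - 2) choose (k - 2)"
      proof -
        have "x \<noteq> y" using B y by blast
        thus ?thesis using card_supersets_le[of V "{x, y}" k] assms(1) by (simp add: numeral_2_eq_2)
      qed
      finally show "card {C \<in> {C \<in> F. x \<in> C}. y \<in> C} \<le> (card V - 2) choose (k - 2)" .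
    qed
    thus ?thesis using finA B by simp
  qed
  have "card F \<le> card A * (k * ((card V - 2) choose (k - 2)))"
  proof (rule card_uniform_inter_le[OF assms(1) F])
    show "finite A" using finA A by blast
    show "A \<inter> B \<noteq> {}" if "B \<in> F" for B using inter A that by blast
  qed (rule deg)
  hence le: "card F \<le> k * k * ((card V - 2) choose (k - 2))" using finA A by (simp add: mult.assoc)
  \<comment> \<open>This keeps the subtraction k - 2 from being truncated.\<close>
  have "k \<noteq> 1"
  proof
    assume "k = 1"
    then obtain x where "A = {x}" using finA A by (metis card_1_singletonE)
    thus False using False inter A by blast
  qed
  then obtain p where p: "k = Suc (Suc p)" using assms(3)
    by (metis One_nat_def not0_implies_Suc less_numeral_extra(3))
  have "k ^ 3 \<ge> 1" using assms(3) by simp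
  then obtain m where m: "card V = Suc (Suc m)" using assms(2)
    by (metis One_nat_def Suc_le_eq less_imp_Suc_add add_Suc_right plus_1_eq_Suc not_less_eq Suc_lessD add_Suc)
  \<comment> \<open>Multiplying by k - 1 prepares the absorption identity (k - 1) ((n - 1) choose (k
    - 1)) = (n - 1) ((n - 2) choose (k - 2)); the threshold enters as k^3 \<le> n - 1.\<close>
  have "Suc p * (k * k * (m choose p)) \<le> k ^ 3 * (m choose p)"
    by (simp add: p power3_eq_cube algebra_simps)
  also have "\<dots> \<le> Suc m * (m choose p)" using assms(2) m by (intro mult_right_mono) auto
  also have "\<dots> = Suc p * (Suc m choose Suc p)" by (simp only: Suc_times_binomial mult.commute)
  finally have "k * k * (m choose p) \<le> Suc m choose Suc p" by (metis Suc_mult_le_cancel1)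
  thus ?thesis using le p m by simp
qed

text \<open>Induction on b. The link of a vertex is (k - 1)-uniform and has no two members meeting
  in b - 1 points, so every degree is at most (n - 2) choose (k - 2), where n = |V|. Double counting
  of incidences turns this into the bound on |F|.\<close>

lemma card_no_inter_le:
  assumes "finite V" and "card V > k ^ 3" and "b < k" and "F \<subseteq> {A. A \<subseteq> V \<and> card A = k}"
    and "\<And>A B. A \<in> F \<Longrightarrow> B \<in> F \<Longrightarrow> card (A \<inter> B) \<noteq> b"
  shows "card F \<le> (card V - 1) choose (k - 1)"
  using assms
proof (induction b arbitrary: k V F)
  case 0
  show ?case
  proof (rule card_intersecting_le[OF "0.prems"(1-4)])
    show "A \<inter> B \<noteq> {}" if "A \<in> F" "B \<in> F" for A B using "0.prems"(5)[OF that] by auto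
  qed
next
  case (Suc b)
  note F = Suc.prems(4)
  have "k = Suc (Suc (k - 2))" using Suc.prems(3) by simp
  then obtain q where q: "k = Suc (Suc q)" by blast
  have Vk: "card V > k" using Suc.prems(2) self_le_power[of k 3] q by simp
  have finF: "finite F" using F Suc.prems(1) by (auto intro: finite_subset[of F "Pow V"])
  have link: "card {A \<in> F. v \<in> A} \<le> (card V - 2) choose q" if v: "v \<in> V" for v
  proof -
    let ?L = "(\<lambda>A. A - {v}) ` {A \<in> F. v \<in> A}"
    have inj: "inj_on (\<lambda>A. A - {v}) {A \<in> F. v \<in> A}" by (auto simp: inj_on_def)
    have "card ?L \<le> (card (V - {v}) - 1) choose (Suc q - 1)"
    proof (rule Suc.IH)
      show "finite (V - {v})" using Suc.prems by simp
      \<comment> \<open>The size condition survives the loss of v: n - 1 \<ge> k^3 > (k -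
        1)^3.\<close>
      have "Suc q ^ 3 < k ^ 3" unfolding q by (rule power_strict_mono) auto
      thus "Suc q ^ 3 < card (V - {v})" using Suc.prems(1,2) v by simp
      show "b < Suc q" using Suc.prems q by simp
      show "?L \<subseteq> {A. A \<subseteq> V - {v} \<and> card A = Suc q}" using F q by auto
      fix A B assume "A \<in> ?L" "B \<in> ?L"
      then obtain A' B' where *: "A' \<in> F" "v \<in> A'" "A = A' - {v}" "B' \<in> F" "v \<in> B'" "B = B' - {v}"
        by blast
      have "A' \<inter> B' = insert v (A \<inter> B)" "v \<notin> A \<inter> B" using * by auto
      moreover have "A \<inter> B \<subseteq> V" using * F by blast
      hence "finite (A \<inter> B)" using Suc.prems(1) by (rule finite_subset)
      ultimately have "card (A' \<inter> B') = Suc (card (A \<inter> B))" by simp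
      thus "card (A \<inter> B) \<noteq> b" using Suc.prems(5) * by metis
    qed
    thus ?thesis using card_image[OF inj] v Suc.prems(1) by (simp add: numeral_2_eq_2)
  qed
  have "k * card F = (\<Sum>A\<in>F. card {v \<in> V. v \<in> A})"
  proof -
    have "card {v \<in> V. v \<in> A} = k" if "A \<in> F" for A
    proof -
      have "{v \<in> V. v \<in> A} = A" using that F by auto
      thus ?thesis using that F by auto
    qed
    thus ?thesis by simp
  qed
  also have "\<dots> = (\<Sum>v\<in>V. card {A \<in> F. v \<in> A})"
    by (rule sum_multicount_gen[symmetric, of V F "\<lambda>v A. v \<in> A"]) (use finF Suc.prems(1) in auto)
  also have "\<dots> \<le> card V * ((card V - 2) choose q)"
    using sum_bounded_above[of V _ "(card V - 2) choose q"] link by simp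
  finally have 1: "k * card F \<le> card V * ((card V - 2) choose q)" .
  have "card V = Suc (Suc (card V - 2))" using Vk q by simp
  then obtain m where m: "card V = Suc (Suc m)" by blast
  have "Suc q * (k * card F) \<le> Suc q * (card V * (m choose q))"
    using 1 m by (intro mult_left_mono) auto
  also have "\<dots> = (Suc q * card V) * (m choose q)" by (simp only: ac_simps)
  \<comment> \<open>(k - 1) n \<le> k (n - 1) is just k \<le> n.\<close>
  also have "\<dots> \<le> (k * Suc m) * (m choose q)"
    using Vk m q by (intro mult_right_mono) (auto simp: algebra_simps)
  also have "\<dots> = k * (Suc q * (Suc m choose Suc q))"
    by (simp only: Suc_times_binomial mult.assoc)
  also have "\<dots> = Suc q * (k * (Suc m choose Suc q))" by (simp only: ac_simps)
  finally have "card F \<le> Suc m choose Suc q" using q by (metis Suc_mult_le_cancel1)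
  thus ?case using q m by simp
qed

text \<open>The contrapositive of \<open>card_no_inter_le\<close>. A and B are distinct
  automatically, since b < k.\<close>

lemma exists_inter_card:
  assumes "finite V" and "card V > k ^ 3" and "b < k" and "F \<subseteq> {A. A \<subseteq> V \<and> card A = k}"
    and "card F > (card V - 1) choose (k - 1)"
  obtains A B where "A \<in> F" "B \<in> F" "card (A \<inter> B) = b"
proof -
  have "\<not> (\<forall>A\<in>F. \<forall>B\<in>F. card (A \<inter> B) \<noteq> b)"
  proof
    assume "\<forall>A\<in>F. \<forall>B\<in>F. card (A \<inter> B) \<noteq> b"
    hence "card F \<le> (card V - 1) choose (k - 1)" by (intro card_no_inter_le[OF assms(1-4)]) blast
    thus False using assms(5) by linarith
  qed
  thus ?thesis using that by blast
qed

section \<open>Extending tilings\<close>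

text \<open>The blocks \<open>{..<k - b}\<close>, \<open>{k - b..<k}\<close> and
  \<open>{k..<2 * k - b}\<close> are mapped to A - B, A \<inter> B and B - A. The first two make up
  one edge of \<open>Y k b\<close>, the last two the other.\<close>

lemma hypergraph_iso_Y:
  assumes "finite A" "finite B" "card A = k" "card B = k" "card (A \<inter> B) = b"
  shows "hypergraph_iso (Y k b) (Hypergraph (A \<union> B) {A, B})"
proof -
  have "b \<le> k" using assms by (metis card_mono inf_le1)
  have cA: "card (A - B) = k - b" using assms by (metis card_Diff_subset_Int finite_Int)
  have cB: "card (B - A) = k - b" using assms by (metis card_Diff_subset_Int finite_Int inf_commute)
  obtain f where f: "bij_betw f {..<k - b} (A - B)"
    using finite_same_card_bij[of "{..<k-b}" "A - B"] cA assms by auto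
  obtain g where g: "bij_betw g {k - b..<k} (A \<inter> B)"
    using finite_same_card_bij[of "{k - b..<k}" "A \<inter> B"] assms \<open>b \<le> k\<close> by auto
  obtain h where h: "bij_betw h {k..<2 * k - b} (B - A)"
    using finite_same_card_bij[of "{k..<2 * k - b}" "B - A"] cB assms \<open>b \<le> k\<close> by auto
  define F where "F i = (if i < k - b then f i else if i < k then g i else h i)" for i
  have F1: "bij_betw F {..<k - b} (A - B)"
    using f by (subst bij_betw_cong[of _ F f]) (auto simp: F_def)
  have F2: "bij_betw F {k - b..<k} (A \<inter> B)"
    using g by (subst bij_betw_cong[of _ F g]) (auto simp: F_def)
  have F3: "bij_betw F {k..<2 * k - b} (B - A)"
    using h by (subst bij_betw_cong[of _ F h]) (auto simp: F_def)
  have F12: "bij_betw F ({..<k - b} \<union> {k - b..<k}) ((A - B) \<union> (A \<inter> B))"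
    using F1 F2 by (rule bij_betw_combine) auto
  have F23: "bij_betw F ({k - b..<k} \<union> {k..<2 * k - b}) ((A \<inter> B) \<union> (B - A))"
    using F2 F3 by (rule bij_betw_combine) auto
  have "bij_betw F (({..<k - b} \<union> {k - b..<k}) \<union> {k..<2 * k - b}) (((A - B) \<union> (A \<inter> B)) \<union> (B - A))"
    using F12 F3 by (rule bij_betw_combine) auto
  moreover have e1: "{..<k - b} \<union> {k - b..<k} = {..<k}" "{k - b..<k} \<union> {k..<2 * k - b} = {k - b..<2 * k - b}"
    "{..<k} \<union> {k..<2 * k - b} = {..<2 * k - b}"
    using \<open>b \<le> k\<close> by auto
  moreover have e2: "(A - B) \<union> (A \<inter> B) = A" "(A \<inter> B) \<union> (B - A) = B" "A \<union> (B - A) = A \<union> B" by auto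
  ultimately have "bij_betw F {..<2 * k - b} (A \<union> B)" by metis
  moreover have "F ` {..<k} = A" "F ` {k - b..<2 * k - b} = B"
    using F12 F23 e1 e2 by (metis bij_betw_imp_surj_on)+
  ultimately show ?thesis unfolding hypergraph_iso_def Y_def by (intro exI[of _ F]) auto
qed

lemma card_tiling_cover:
  assumes "tiling (Y k b) H \<T>"
  shows "card (\<Union>C\<in>\<T>. verts C) \<le> (2 * k - b) * card \<T>" and "finite (\<Union>C\<in>\<T>. verts C)"
proof -
  have C: "card (verts C) = 2 * k - b \<and> finite (verts C)" if "C \<in> \<T>" for C
    using assms that unfolding tiling_def copy_in_def hypergraph_iso_def Y_def
    by (metis bij_betw_finite bij_betw_same_card card_lessThan finite_lessThan hypergraph.sel(1))
  have fin: "finite \<T>" using assms by (simp add: tiling_def)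
  show "finite (\<Union>C\<in>\<T>. verts C)" using C fin by auto
  have "card (\<Union>C\<in>\<T>. verts C) \<le> (\<Sum>C\<in>\<T>. card (verts C))" by (rule card_UN_le[OF fin])
  also have "\<dots> = (2 * k - b) * card \<T>" using C by simp
  finally show "card (\<Union>C\<in>\<T>. verts C) \<le> (2 * k - b) * card \<T>" .
qed

lemma tiling_mono:
  assumes "tiling F G \<T>" and "subhypergraph G H"
  shows "tiling F H \<T>"
  using assms unfolding tiling_def copy_in_def subhypergraph_def by blast

lemma tiling_extend:
  assumes "tiling (Y k b) H \<T>" and "kgraph k H" and "0 < k"
    and "A \<in> edges H" "B \<in> edges H" "card (A \<inter> B) = b"
    and "(A \<union> B) \<inter> (\<Union>C\<in>\<T>. verts C) = {}"
  shows "\<exists>\<T>'. tiling (Y k b) H \<T>' \<and> card \<T>' = Suc (card \<T>)"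
proof -
  let ?C = "Hypergraph (A \<union> B) {A, B}"
  have AB: "A \<subseteq> verts H" "B \<subseteq> verts H" "card A = k" "card B = k" "finite A" "finite B"
    using assms(2,4,5) unfolding kgraph_def by (auto intro: finite_subset)
  \<comment> \<open>A nonempty vertex set disjoint from the cover shows that the copy is new, so the
    cardinality really grows.\<close>
  have "A \<noteq> {}" using AB assms(3) by auto
  hence new: "?C \<notin> \<T>" using assms(7) by fastforce
  have "copy_in (Y k b) H ?C"
    unfolding copy_in_def subhypergraph_def using AB assms hypergraph_iso_Y[of A B k b] by simp
  moreover have "disjoint_family_on verts (insert ?C \<T>)"
    using assms(1,7) new by (subst disjoint_family_on_insert) (auto simp: tiling_def)
  ultimately have "tiling (Y k b) H (insert ?C \<T>)" using assms(1) by (simp add: tiling_def)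
  moreover have "card (insert ?C \<T>) = Suc (card \<T>)" using new assms(1) by (simp add: tiling_def)
  ultimately show ?thesis by blast
qed

section \<open>Binomial estimates\<close>

text \<open>By Pascal's rule each of the j increments is at least the first one.\<close>

lemma binomial_add_ge: "(m choose Suc p) + j * (m choose p) \<le> (m + j) choose Suc p"
proof (induction j)
  case (Suc j)
  have "m choose p \<le> (m + j) choose p" by (rule binomial_right_mono) simp
  thus ?case using Suc by simp
qed simp

text \<open>Here each increment is at most the last one, which is (m + j) choose p because the sum
  starts at \<open>Suc m\<close>.\<close>

lemma binomial_add_le: "(Suc m + j) choose Suc p \<le> (Suc m choose Suc p) + j * ((m + j) choose p)"
proof (induction j)
  case (Suc j)
  have "(m + j) choose p \<le> (m + Suc j) choose p" by (rule binomial_right_mono) simp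
  hence "j * ((m + j) choose p) \<le> j * ((m + Suc j) choose p)" by (rule mult_left_mono) simp
  moreover have "(Suc m + Suc j) choose Suc p = ((m + Suc j) choose p) + ((Suc m + j) choose Suc p)"
    by simp
  ultimately show ?case using Suc.IH unfolding mult_Suc by linarith
qed simp

text \<open>Read n = m + 2, k = q + 2, s = r + 1. The first summand bounds the number of edges
  meeting t r vertices of small degree. Its part quadratic in r is absorbed by (n choose k) - ((n -
  r) choose k) \<ge> r ((n - r) choose (k - 1)), its linear part by the last term on the
  right.\<close>

lemma binomial_tiling_bound:
  fixes m q r t :: nat
  assumes "t > 0" and "q \<le> Suc m" and "r \<le> m" and n: "Suc q * ((t\<^sup>2 + 1) * r) \<le> Suc m"
  shows "t * r * ((t * r + 1) * (m choose q)) + (Suc (Suc m) - r choose Suc (Suc q))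
     < (Suc (Suc m) choose Suc (Suc q)) + (Suc m choose q) * t * Suc r"
proof -
  define c where "c = m choose q"
  define d where "d = Suc m choose q"
  define a where "a = (Suc (Suc m) - r) choose Suc q"
  have "c \<le> d" unfolding c_def d_def by (rule binomial_right_mono) simp
  have "d > 0" using assms(2) by (simp add: d_def)
  have quad: "r * (t\<^sup>2 * r * c) \<le> r * a"
  proof (cases r)
    case (Suc j)
    have "Suc (m - j) + j = Suc m" "m - j + j = m" using assms(3) Suc by auto
    hence "Suc m choose Suc q \<le> (Suc (m - j) choose Suc q) + j * c"
      using binomial_add_le[of "m - j" j q] by (simp add: c_def)
    also have "\<dots> = a + j * c" using Suc assms(3) by (simp add: a_def Suc_diff_le)
    finally have 1: "Suc q * (Suc m choose Suc q) \<le> Suc q * (a + j * c)" by (rule mult_left_mono) simp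
    have "Suc q * ((t\<^sup>2 + 1) * r * c) = Suc q * ((t\<^sup>2 + 1) * r) * c"
      by (simp only: mult.assoc)
    also have "\<dots> \<le> Suc m * c" using n by (rule mult_right_mono) simp
    also have "\<dots> = Suc q * (Suc m choose Suc q)" unfolding c_def by (simp only: Suc_times_binomial)
    finally have "Suc q * ((t\<^sup>2 + 1) * r * c) \<le> Suc q * (a + j * c)" using 1 by linarith
    hence "(t\<^sup>2 + 1) * r * c \<le> a + j * c" by (metis Suc_mult_le_cancel1)
    \<comment> \<open>The extra 1 in t^2 + 1 contributes r c, which pays for j c since j <
      r.\<close>
    hence "t\<^sup>2 * r * c \<le> a" using Suc by (simp add: algebra_simps)
    thus ?thesis by (rule mult_left_mono) simp
  qed simp
  have "t * r * ((t * r + 1) * c) = r * (t\<^sup>2 * r * c) + t * r * c"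
    by (simp add: power2_eq_square algebra_simps)
  also have "\<dots> \<le> r * a + t * r * d" using quad \<open>c \<le> d\<close> by (intro add_mono mult_left_mono) auto
  \<comment> \<open>Strictness comes from passing from r to \<open>Suc r\<close>.\<close>
  also have "\<dots> < r * a + d * t * Suc r" using \<open>d > 0\<close> assms(1) by (simp add: algebra_simps)
  finally have "t * r * ((t * r + 1) * c) < r * a + d * t * Suc r" .
  moreover have "(Suc (Suc m) - r choose Suc (Suc q)) + r * a \<le> Suc (Suc m) choose Suc (Suc q)"
    using binomial_add_ge[of "Suc (Suc m) - r" "Suc q" r] assms(3) by (simp add: a_def)
  ultimately show ?thesis by (simp add: c_def d_def)
qed

section \<open>Induction on the size of the tiling\<close>

lemma card_edges_through_le:
  assumes "kgraph k H"
  shows "card {e \<in> edges H. v \<in> e} \<le> (card (verts H) - 1) choose (k - 1)"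
proof -
  have fin: "finite (verts H)" using assms by (simp add: kgraph_def)
  have "{e \<in> edges H. v \<in> e} \<subseteq> {e. {v} \<subseteq> e \<and> e \<subseteq> verts H \<and> card e = k}"
    using assms by (auto simp: kgraph_def)
  moreover have "finite {e. {v} \<subseteq> e \<and> e \<subseteq> verts H \<and> card e = k}"
    using fin by (auto intro: finite_subset[of _ "Pow (verts H)"])
  ultimately have "card {e \<in> edges H. v \<in> e} \<le> card {e. {v} \<subseteq> e \<and> e \<subseteq> verts H \<and> card e = k}"
    by (rule card_mono[rotated])
  also have "\<dots> \<le> (card (verts H) - 1) choose (k - 1)"
    using card_supersets_le[of "verts H" "{v}" k] fin by simp
  finally show ?thesis .
qed

text \<open>Each x in U shares at most (n - 2) choose (k - 2) edges with v, where n is the number of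
  vertices. So more than that many edges through v avoid U, and in the link of v two of them meet in
  b - 1 points; v is the b-th common point.\<close>

lemma edges_through_meeting:
  assumes H: "kgraph k H" and b: "0 < b" "b < k" and big: "card (verts H) > k ^ 3"
    and v: "v \<in> verts H" and U: "finite U" "v \<notin> U"
    and deg: "card {e \<in> edges H. v \<in> e} > (card U + 1) * ((card (verts H) - 2) choose (k - 2))"
  obtains A B where "A \<in> edges H" "B \<in> edges H" "card (A \<inter> B) = b" "(A \<union> B) \<inter> U = {}"
proof -
  let ?V = "verts H" and ?D = "{e \<in> edges H. v \<in> e}"
  let ?c = "(card ?V - 2) choose (k - 2)"
  have fin: "finite ?V" and E: "\<And>e. e \<in> edges H \<Longrightarrow> e \<subseteq> ?V \<and> card e = k"
    using H by (auto simp: kgraph_def)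
  have "k = Suc (Suc (k - 2))" using b by simp
  then obtain q where q: "k = Suc (Suc q)" by blast
  have finE: "finite (edges H)" using fin E by (auto intro: finite_subset[of _ "Pow ?V"])
  let ?R = "{e \<in> ?D. U \<inter> e = {}}"
  have "card ?D \<le> card U * ?c + card ?R"
  proof (rule card_le_meeting_plus_avoiding[OF fin _ U(1)])
    show "?D \<subseteq> {A. A \<subseteq> ?V \<and> card A = k}" using E by blast
    fix x assume x: "x \<in> U"
    have "{e \<in> ?D. x \<in> e} \<subseteq> {e. {v, x} \<subseteq> e \<and> e \<subseteq> ?V \<and> card e = k}" using E by blast
    moreover have "finite {e. {v, x} \<subseteq> e \<and> e \<subseteq> ?V \<and> card e = k}"
      using fin by (auto intro: finite_subset[of _ "Pow ?V"])
    ultimately have "card {e \<in> ?D. x \<in> e} \<le> card {e. {v, x} \<subseteq> e \<and> e \<subseteq> ?V \<and> card e = k}"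
      by (rule card_mono[rotated])
    also have "\<dots> \<le> ?c"
    proof -
      have "v \<noteq> x" using U x by blast
      thus ?thesis using card_supersets_le[of ?V "{v, x}" k] fin by (simp add: numeral_2_eq_2)
    qed
    finally show "card {e \<in> ?D. x \<in> e} \<le> ?c" .
  qed
  hence R: "card ?R > ?c" using deg by simp
  let ?L = "(\<lambda>e. e - {v}) ` ?R"
  have cL: "card ?L = card ?R" by (intro card_image) (auto simp: inj_on_def)
  obtain A' B' where AB': "A' \<in> ?L" "B' \<in> ?L" "card (A' \<inter> B') = b - 1"
  proof (rule exists_inter_card[of "?V - {v}" "Suc q" "b - 1" ?L])
    show "finite (?V - {v})" using fin by simp
    have "Suc q ^ 3 < k ^ 3" unfolding q by (rule power_strict_mono) auto
    thus "Suc q ^ 3 < card (?V - {v})" using big v fin by simp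
    show "b - 1 < Suc q" using b q by simp
    show "?L \<subseteq> {A. A \<subseteq> ?V - {v} \<and> card A = Suc q}"
    proof
      fix A assume "A \<in> ?L"
      then obtain e where e: "e \<in> edges H" "v \<in> e" "A = e - {v}" by blast
      thus "A \<in> {A. A \<subseteq> ?V - {v} \<and> card A = Suc q}" using E[OF e(1)] q by auto
    qed
    show "card ?L > (card (?V - {v}) - 1) choose (Suc q - 1)"
      unfolding cL using R v fin q by (simp add: numeral_2_eq_2)
  qed blast
  then obtain A B where AB: "A \<in> ?R" "B \<in> ?R" "A' = A - {v}" "B' = B - {v}" by blast
  have "A \<inter> B = insert v (A' \<inter> B')" "v \<notin> A' \<inter> B'" using AB by auto
  moreover have "A' \<inter> B' \<subseteq> ?V" using AB E by blast
  hence "finite (A' \<inter> B')" using fin by (rule finite_subset)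
  ultimately have "card (A \<inter> B) = b" using AB'(3) b by simp
  moreover have "A \<in> edges H" "B \<in> edges H" "(A \<union> B) \<inter> U = {}" using AB by auto
  ultimately show ?thesis using that by blast
qed

text \<open>At most |U| d edges meet U. The others are still regarded as a family on all of
  \<open>verts H\<close>, so the size condition carries over unchanged.\<close>

lemma edges_outside_meeting:
  assumes H: "kgraph k H" and b: "b < k" and big: "card (verts H) > k ^ 3" and U: "finite U"
    and deg: "\<And>v. v \<in> U \<Longrightarrow> card {e \<in> edges H. v \<in> e} \<le> d"
    and many: "card (edges H) > card U * d + ((card (verts H) - 1) choose (k - 1))"
  obtains A B where "A \<in> edges H" "B \<in> edges H" "card (A \<inter> B) = b" "(A \<union> B) \<inter> U = {}"
proof -
  let ?R = "{e \<in> edges H. U \<inter> e = {}}"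
  have fin: "finite (verts H)" and E: "edges H \<subseteq> {e. e \<subseteq> verts H \<and> card e = k}"
    using H by (auto simp: kgraph_def)
  have "card (edges H) \<le> card U * d + card ?R"
    by (rule card_le_meeting_plus_avoiding[OF fin E U deg])
  hence "card ?R > (card (verts H) - 1) choose (k - 1)" using many by linarith
  moreover have "?R \<subseteq> {e. e \<subseteq> verts H \<and> card e = k}" using E by blast
  ultimately obtain A B where "A \<in> ?R" "B \<in> ?R" "card (A \<inter> B) = b"
    using exists_inter_card[OF fin big b] by blast
  thus ?thesis using that by blast
qed

text \<open>The invariant of the induction, with t standing for 2 k - b. The subtracted binomial is
  moved to the other side to stay in the naturals. The condition n > s + k^3 replaces a lower bound
  on s, so that the induction can descend to s = 0.\<close>

definition large_kgraph :: "nat \<Rightarrow> nat \<Rightarrow> nat \<Rightarrow> 'a hypergraph \<Rightarrow> bool" where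
  "large_kgraph k t s H \<longleftrightarrow> kgraph k H \<and> card (verts H) > s + k ^ 3
     \<and> card (verts H) \<ge> (2 * t\<^sup>2 + 1) * (k - 1) * s + s
     \<and> (card (verts H) choose k) + ((card (verts H) - 1) choose (k - 1))
        + ((card (verts H) - 1) choose (k - 2)) * t * s
       \<le> card (edges H) + ((card (verts H) - s + 1) choose k)"

definition delete_vertex :: "'a hypergraph \<Rightarrow> 'a \<Rightarrow> 'a hypergraph" where
  "delete_vertex H v = Hypergraph (verts H - {v}) {e \<in> edges H. v \<notin> e}"

lemma subhypergraph_delete_vertex: "subhypergraph (delete_vertex H v) H"
  by (auto simp: subhypergraph_def delete_vertex_def)

text \<open>As n and s both drop by one, n - s + 1 is unchanged. The at most (n - 1) choose (k - 1)
  lost edges are balanced by (n choose k) - ((n - 1) choose k), and the remaining terms of the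
  threshold do not increase.\<close>

lemma large_kgraph_delete_vertex:
  assumes H: "large_kgraph k t (Suc s) H" and k: "k \<ge> 2" and v: "v \<in> verts H"
  shows "large_kgraph k t s (delete_vertex H v)"
proof -
  let ?n = "card (verts H)" and ?G = "delete_vertex H v"
  have kH: "kgraph k H" and fin: "finite (verts H)" using H by (auto simp: large_kgraph_def kgraph_def)
  have finE: "finite (edges H)"
    using kH fin by (auto simp: kgraph_def intro: finite_subset[of _ "Pow (verts H)"])
  have n: "?n > Suc s + k ^ 3" using H by (simp add: large_kgraph_def)
  then obtain m where m: "?n = Suc (Suc m)" using k self_le_power[of k 3]
    by (metis add_Suc less_imp_Suc_add)
  obtain q where q: "k = Suc (Suc q)" using k by (metis add_2_eq_Suc le_Suc_ex)
  have cG: "card (verts ?G) = Suc m" using v fin m by (simp add: delete_vertex_def)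
  have "edges H = {e \<in> edges H. v \<in> e} \<union> edges ?G" "{e \<in> edges H. v \<in> e} \<inter> edges ?G = {}"
    by (auto simp: delete_vertex_def)
  hence "card (edges H) = card {e \<in> edges H. v \<in> e} + card (edges ?G)"
    using finE by (metis card_Un_disjoint finite_Un)
  moreover have "card {e \<in> edges H. v \<in> e} \<le> Suc m choose Suc q"
    using card_edges_through_le[OF kH, of v] q m by simp
  moreover have "(Suc (Suc m) choose Suc (Suc q)) + (Suc m choose Suc q) + (Suc m choose q) * t * Suc s
       \<le> card (edges H) + ((Suc m - s + 1) choose Suc (Suc q))"
    using H m q by (simp add: large_kgraph_def)
  moreover have "m choose Suc q \<le> Suc m choose Suc q" by (rule binomial_right_mono) simp
  moreover have "(m choose q) * t * s \<le> (Suc m choose q) * t * Suc s"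
    by (intro mult_mono binomial_right_mono) auto
  ultimately have "(Suc m choose Suc (Suc q)) + (m choose Suc q) + (m choose q) * t * s
       \<le> card (edges ?G) + ((Suc m - s + 1) choose Suc (Suc q))"
    using binomial_Suc_Suc[of "Suc m" "Suc q"] by linarith
  moreover have "kgraph k ?G" using kH by (auto simp: kgraph_def delete_vertex_def)
  moreover have "(2 * t\<^sup>2 + 1) * (k - 1) * s + s \<le> Suc m"
  proof -
    have "(2 * t\<^sup>2 + 1) * (k - 1) * s \<le> (2 * t\<^sup>2 + 1) * (k - 1) * Suc s"
      by (rule mult_left_mono) auto
    thus ?thesis using H m unfolding large_kgraph_def by linarith
  qed
  ultimately show ?thesis unfolding large_kgraph_def cG using n m q by simp
qed

lemma large_kgraph_tiling:
  assumes "large_kgraph k (2 * k - b) s H" and k: "k \<ge> 2" and b: "0 < b" "b < k"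
  shows "\<exists>\<T>. tiling (Y k b) H \<T> \<and> card \<T> = s"
  using assms(1)
proof (induction s arbitrary: H)
  case 0
  show ?case by (intro exI[of _ "{}"]) (simp add: tiling_def disjoint_family_on_def)
next
  case (Suc r)
  define t where "t = 2 * k - b"
  have "t > 0" using b by (simp add: t_def)
  let ?n = "card (verts H)"
  note H = Suc.prems[folded t_def]
  have kH: "kgraph k H" and fin: "finite (verts H)" using H by (auto simp: large_kgraph_def kgraph_def)
  have n: "?n > Suc r + k ^ 3" using H by (simp add: large_kgraph_def)
  have "k ^ 3 \<ge> k" using k self_le_power[of k 3] by simp
  then obtain m where m: "?n = Suc (Suc m)" using n k by (metis add_Suc less_imp_Suc_add)
  obtain q where q: "k = Suc (Suc q)" using k by (metis add_2_eq_Suc le_Suc_ex)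
  have rm: "r \<le> m" "q \<le> m" using n m q \<open>k ^ 3 \<ge> k\<close> by linarith+
  have big: "?n > k ^ 3" using n by simp
  \<comment> \<open>The tiling is found in H - v and therefore depends on v.\<close>
  have small: "\<exists>\<T>. tiling (Y k b) H \<T> \<and> card \<T> = r \<and> v \<notin> (\<Union>C\<in>\<T>. verts C)"
    if v: "v \<in> verts H" for v
  proof -
    obtain \<T> where T: "tiling (Y k b) (delete_vertex H v) \<T>" "card \<T> = r"
      using Suc.IH large_kgraph_delete_vertex[OF H k v] by (auto simp: t_def)
    hence "v \<notin> (\<Union>C\<in>\<T>. verts C)"
      by (auto simp: tiling_def copy_in_def subhypergraph_def delete_vertex_def)
    thus ?thesis using tiling_mono[OF T(1) subhypergraph_delete_vertex] T(2) by blast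
  qed
  \<comment> \<open>The degree cut-off required by \<open>edges_through_meeting\<close> when U is
    the set of at most t r vertices covered by a tiling of size r.\<close>
  define d where "d = (t * r + 1) * (m choose q)"
  have "\<exists>\<T> A B. tiling (Y k b) H \<T> \<and> card \<T> = r \<and> A \<in> edges H \<and> B \<in> edges H
    \<and> card (A \<inter> B) = b \<and> (A \<union> B) \<inter> (\<Union>C\<in>\<T>. verts C) = {}"
  proof (cases "\<exists>v\<in>verts H. card {e \<in> edges H. v \<in> e} > d")
    case True
    then obtain v where v: "v \<in> verts H" "card {e \<in> edges H. v \<in> e} > d" by blast
    obtain \<T> where T: "tiling (Y k b) H \<T>" "card \<T> = r" "v \<notin> (\<Union>C\<in>\<T>. verts C)"
      using small[OF v(1)] by blast
    have U: "card (\<Union>C\<in>\<T>. verts C) \<le> t * r" "finite (\<Union>C\<in>\<T>. verts C)"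
      using card_tiling_cover[OF T(1)] T(2) by (auto simp: t_def)
    have "(card (\<Union>C\<in>\<T>. verts C) + 1) * ((?n - 2) choose (k - 2)) \<le> d"
      unfolding d_def m q using U(1) by (intro mult_mono) auto
    from le_less_trans[OF this v(2)] show ?thesis
      using edges_through_meeting[OF kH b big v(1) U(2) T(3)] T by metis
  next
    case False
    \<comment> \<open>Any vertex serves; its deletion only supplies a tiling of size r.\<close>
    obtain v where v: "v \<in> verts H" using big by fastforce
    obtain \<T> where T: "tiling (Y k b) H \<T>" "card \<T> = r" using small[OF v] by blast
    let ?U = "\<Union>C\<in>\<T>. verts C"
    have U: "card ?U \<le> t * r" "finite ?U"
      using card_tiling_cover[OF T(1)] T(2) by (auto simp: t_def)
    have UV: "?U \<subseteq> verts H" using T(1) by (auto simp: tiling_def copy_in_def subhypergraph_def)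
    have "Suc q * ((t\<^sup>2 + 1) * r) \<le> (2 * t\<^sup>2 + 1) * (k - 1) * Suc r"
    proof -
      have "Suc q * ((t\<^sup>2 + 1) * r) = (t\<^sup>2 + 1) * Suc q * r" by (simp only: ac_simps)
      also have "\<dots> \<le> (2 * t\<^sup>2 + 1) * (k - 1) * Suc r" using q by (intro mult_mono) auto
      finally show ?thesis .
    qed
    hence "Suc q * ((t\<^sup>2 + 1) * r) \<le> Suc m" using H m unfolding large_kgraph_def by linarith
    from binomial_tiling_bound[OF \<open>t > 0\<close> _ rm(1) this]
    have "t * r * d + (Suc (Suc m) - r choose Suc (Suc q))
       < (Suc (Suc m) choose Suc (Suc q)) + (Suc m choose q) * t * Suc r"
      using rm by (simp add: d_def)
    moreover have "(Suc (Suc m) choose Suc (Suc q)) + (Suc m choose Suc q) + (Suc m choose q) * t * Suc r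
       \<le> card (edges H) + ((Suc (Suc m) - r) choose Suc (Suc q))"
    proof -
      \<comment> \<open>With s = r + 1 the upper index n - s + 1 is n - r, as in
        \<open>binomial_tiling_bound\<close>.\<close>
      have "?n - Suc r + 1 = Suc (Suc m) - r" using m rm by simp
      thus ?thesis using H unfolding large_kgraph_def m q by simp
    qed
    moreover have "card ?U * d \<le> t * r * d" using U(1) by (rule mult_right_mono) simp
    ultimately have "card (edges H) > card ?U * d + (Suc m choose Suc q)" by linarith
    hence "card (edges H) > card ?U * d + ((?n - 1) choose (k - 1))" using m q by simp
    moreover have "card {e \<in> edges H. u \<in> e} \<le> d" if "u \<in> ?U" for u
      using False UV that by (meson not_le subsetD)
    ultimately show ?thesis using edges_outside_meeting[OF kH b(2) big U(2), of d] T by metis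
  qed
  then obtain \<T> A B where "tiling (Y k b) H \<T>" "card \<T> = r" "A \<in> edges H" "B \<in> edges H"
    "card (A \<inter> B) = b" "(A \<union> B) \<inter> (\<Union>C\<in>\<T>. verts C) = {}" by blast
  thus ?case using tiling_extend[of k b H \<T> A B] kH k by auto
qed

theorem theorem1p3:
  fixes k b :: nat
  assumes "k \<ge> 3" and "1 \<le> b" and "b \<le> k - 1"
  shows "\<exists>s\<^sub>0::nat. s\<^sub>0 > 0 \<and>
    (\<forall>s\<ge>s\<^sub>0. \<forall>(H::'a hypergraph) n::nat.
       kgraph k H \<and> card (verts H) = n \<and>
       n \<ge> (2 * (2 * k - b)^2 + 1) * (k - 1) * s + s \<and>
       int (card (edges H)) \<ge> int (n choose k) - int ((n - s + 1) choose k)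
           + int ((n - 1) choose (k - 1)) + int ((n - 1) choose (k - 2)) * int (2 * k - b) * int s
       \<longrightarrow> (\<exists>\<T>. tiling (Y k b) H \<T> \<and> card \<T> = s))"
proof (intro exI[of _ "Suc (k ^ 3)"] conjI allI impI)
  show "Suc (k ^ 3) > 0" by simp
  fix s n :: nat and H :: "'a hypergraph"
  assume s: "s \<ge> Suc (k ^ 3)"
  assume *: "kgraph k H \<and> card (verts H) = n \<and>
       n \<ge> (2 * (2 * k - b)^2 + 1) * (k - 1) * s + s \<and>
       int (card (edges H)) \<ge> int (n choose k) - int ((n - s + 1) choose k)
           + int ((n - 1) choose (k - 1)) + int ((n - 1) choose (k - 2)) * int (2 * k - b) * int s"
  \<comment> \<open>This gives n \<ge> s + s, and s > k^3 by the choice of the threshold for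
    s.\<close>
  have "1 * 1 * s \<le> (2 * (2 * k - b)^2 + 1) * (k - 1) * s"
    using assms by (intro mult_mono) auto
  hence "n > s + k ^ 3" using * s by linarith
  \<comment> \<open>With the negative binomial moved across, the inequality passes from the integers
    to the naturals.\<close>
  moreover have "int ((n choose k) + ((n - 1) choose (k - 1)) + ((n - 1) choose (k - 2)) * (2 * k - b) * s)
     \<le> int (card (edges H) + ((n - s + 1) choose k))"
    using * by (simp only: of_nat_add of_nat_mult) linarith
  ultimately have "large_kgraph k (2 * k - b) s H"
    using * unfolding large_kgraph_def of_nat_le_iff by blast
  thus "\<exists>\<T>. tiling (Y k b) H \<T> \<and> card \<T> = s"
    using assms by (intro large_kgraph_tiling) auto
qed

end
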